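(* Let $a, b$ be nonzero integers with $|a| \neq 1$. Then there exist constants $c>0$ and $x_0$, depending on $a$ and $b$, such that for all $x \geq x_0$, $$\#\{p \leq x \text{ prime} : p \nmid ab \text{ and } b \bmod p \in \langle a \bmod p \rangle \subset \mathbb{F}_p^*\} \geq c \log x .$$
   Context: Here $\langle a \bmod p\rangle$ denotes the cyclic subgroup of the multiplicative group $\mathbb{F}_p^*$ generated by the residue of $a$ modulo $p$; the condition $b \bmod p \in \langle a \bmod p\rangle$ means $b \equiv a^n \pmod p$ for some integer $n \geq 0$. *)

theory Defs
  imports Complex_Main "HOL-Number_Theory.Number_Theory"
begin

definition cyclic_subgroup_mod :: "int \<Rightarrow> nat \<Rightarrow> int set" where
  "cyclic_subgroup_mod a p = generate (mult_of (residue_ring (int p))) {a mod int p}"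

lemma mod_in_cyclic_subgroup_mod_iff:
  assumes "prime p" and "\<not> int p dvd a"
  shows "b mod int p \<in> cyclic_subgroup_mod a p \<longleftrightarrow> (\<exists>n::nat. [b = a ^ n] (mod int p))"
proof -
  let ?R = "residue_ring (int p)"
  interpret residues_prime p ?R
    by unfold_locales (use assms(1) in simp_all)
  interpret G: group "mult_of ?R"
    by (rule field_mult_group)
  have a: "a mod int p \<in> carrier (mult_of ?R)"
    using assms(2) by (simp add: res_zero_eq dvd_eq_mod_eq_0)
  have fin: "finite (carrier (mult_of ?R))"
    by (rule finite_mult_of) simp
  show ?thesis
    unfolding cyclic_subgroup_mod_def G.generate_pow_on_finite_carrier[OF fin a]
    by (auto simp: nat_pow_mult_of pow_cong cong_def)
qed

(* For a real bound x the set below is finite, so card is the true cardinality. *)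
definition primes_with_power_residue :: "int \<Rightarrow> int \<Rightarrow> real \<Rightarrow> nat set" where
  "primes_with_power_residue a b x =
     {p::nat. prime p \<and> real p \<le> x \<and> \<not> int p dvd a * b \<and> b mod int p \<in> cyclic_subgroup_mod a p}"

lemma finite_primes_with_power_residue: "finite (primes_with_power_residue a b x)"
proof (rule finite_subset)
  show "primes_with_power_residue a b x \<subseteq> {..nat \<lfloor>x\<rfloor>}"
    by (auto simp: primes_with_power_residue_def le_nat_floor)
qed simp

end

theory Submission
  imports Defs
begin

text \<open>
  A counting version of Polya's argument. The numbers \<open>a ^ n - b\<close> with \<open>M < n \<le> 2 * M\<close> have a product whose
  logarithm is at least \<open>M\<^sup>2 ln \<bar>a\<bar>\<close>, and their prime factors \<open>p \<le> \<bar>a\<bar> ^ (3 * M)\<close> that do not divide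
  \<open>a * b\<close> are counted by the theorem. So it suffices that each single prime contributes only \<open>O(M)\<close>
  to this logarithm. For \<open>p\<close> not dividing \<open>a * b\<close>, fix an exponent \<open>N\<close> at which the \<open>p\<close>-adic valuation is
  maximal. This term costs \<open>O(M)\<close>, and every other valuation is at most that of \<open>a ^ \<bar>n - N\<bar> - 1\<close>.
  Lifting the exponent shows that the valuations of \<open>a ^ m - 1\<close>, summed over \<open>m \<le> M\<close>, also cost \<open>O(M)\<close>:
  they vanish unless the order \<open>r\<close> of \<open>a\<close> divides \<open>m\<close>, and \<open>p\<close>-powers dividing \<open>a ^ r - 1\<close>
  are bounded by \<open>\<bar>a\<bar> ^ r + 1\<close>.
\<close>

section \<open>Sums of valuations along multiples of a fixed number\<close>

lemma sum_multiples:
  fixes f :: "nat \<Rightarrow> nat"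
  assumes "d > 0" and "\<And>m. \<not> d dvd m \<Longrightarrow> f m = 0"
  shows "(\<Sum>m=1..M. f m) = (\<Sum>k=1..M div d. f (d * k))"
proof -
  have inj: "inj_on ((*) d) {1..M div d}"
    using assms(1) by (auto simp: inj_on_def)
  have "(\<Sum>m=1..M. f m) = (\<Sum>m\<in>(*) d ` {1..M div d}. f m)"
  proof (rule sum.mono_neutral_right)
    show "(*) d ` {1..M div d} \<subseteq> {1..M}"
      using assms(1) by (auto simp: less_eq_div_iff_mult_less_eq mult.commute)
    show "\<forall>m\<in>{1..M} - (*) d ` {1..M div d}. f m = 0"
    proof (intro ballI, rule assms(2), rule notI)
      fix m assume m: "m \<in> {1..M} - (*) d ` {1..M div d}" and "d dvd m"
      then obtain k where k: "m = d * k" by blast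
      then have "k \<in> {1..M div d}"
        using m assms(1) by (auto simp: less_eq_div_iff_mult_less_eq mult.commute)
      then show False using m k by blast
    qed
  qed simp
  also have "\<dots> = (\<Sum>k=1..M div d. f (d * k))"
    by (subst sum.reindex[OF inj]) simp
  finally show ?thesis .
qed

text \<open>By Legendre's formula this sum is the valuation of \<open>K!\<close>. Only the multiples
  \<open>p * k\<close> contribute, each \<open>1 + multiplicity p k\<close>, so with
  \<open>q = K div p\<close> the sum up to \<open>K\<close> is \<open>q\<close> plus the sum up to
  \<open>q\<close>, and induction gives at most \<open>2 * q \<le> K\<close>.\<close>

lemma sum_multiplicity_le:
  fixes p :: nat
  assumes "prime p"
  shows "(\<Sum>k=1..K. multiplicity p k) \<le> K"
proof (induction K rule: less_induct)
  case (less K)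
  have p: "p \<ge> 2" using assms by (rule prime_ge_2_nat)
  show ?case
  proof (cases "K = 0")
    case False
    define q where "q = K div p"
    have "q < K" using False p by (simp add: q_def)
    have "2 * q \<le> p * q" using p by simp
    also have "p * q \<le> K" by (simp add: q_def)
    finally have q: "2 * q \<le> K" .
    have "(\<Sum>k=1..K. multiplicity p k) = (\<Sum>k=1..q. multiplicity p (p * k))"
      unfolding q_def using p by (intro sum_multiples not_dvd_imp_multiplicity_0) auto
    also have "\<dots> = (\<Sum>k=1..q. 1 + multiplicity p k)"
      using assms by (intro sum.cong refl) (auto simp: prime_elem_multiplicity_mult_distrib)
    also have "\<dots> = q + (\<Sum>k=1..q. multiplicity p k)"
      by (simp only: sum.distrib) simp
    also have "\<dots> \<le> q + q" using less.IH[OF \<open>q < K\<close>] by simp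
    finally show ?thesis using q by simp
  qed simp
qed

section \<open>Lifting the exponent, as an upper bound\<close>

lemma cong_one_add_power:
  fixes p t :: int
  shows "[(1 + p * t) ^ i = 1 + int i * p * t] (mod p ^ 2)"
proof (induction i)
  case (Suc i)
  have "[(1 + p * t) ^ Suc i = (1 + p * t) * (1 + int i * p * t)] (mod p ^ 2)"
    using Suc by (auto intro: cong_scalar_left)
  also have "(1 + p * t) * (1 + int i * p * t) = 1 + int (Suc i) * p * t + p ^ 2 * (int i * t ^ 2)"
    by (simp add: algebra_simps power2_eq_square)
  also have "[\<dots> = 1 + int (Suc i) * p * t] (mod p ^ 2)"
    by (simp add: cong_iff_dvd_diff)
  finally show ?case .
qed simp

text \<open>With \<open>D = 1 + p * t\<close>, linearising the powers modulo
  \<open>p\<^sup>2\<close> turns the sum into \<open>p + p * t * S\<close>, where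
  \<open>S = p * (p - 1) / 2\<close>. For odd \<open>p\<close>, \<open>p\<close> divides
  \<open>S\<close>; for \<open>p = 2\<close> the congruence modulo 4 makes \<open>t\<close> even.
  Either way the sum is \<open>p\<close> modulo \<open>p\<^sup>2\<close>, hence not divisible by
  \<open>p\<^sup>2\<close>.\<close>

lemma multiplicity_geometric_sum_le:
  fixes D :: int
  assumes p: "prime p" and D: "[D = 1] (mod int p)" and D4: "p = 2 \<Longrightarrow> [D = 1] (mod 4)"
  shows "multiplicity (int p) (\<Sum>i<p. D ^ i) \<le> 1"
proof -
  from D obtain t where "D - 1 = int p * t"
    by (auto simp: cong_iff_dvd_diff)
  then have t: "D = 1 + int p * t" by simp
  define S where "S = (\<Sum>i<p. int i)"
  have "[(\<Sum>i<p. D ^ i) = (\<Sum>i<p. 1 + int i * int p * t)] (mod int p ^ 2)"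
    unfolding t by (intro cong_sum cong_one_add_power)
  also have "(\<Sum>i<p. 1 + int i * int p * t) = int p + int p * (t * S)"
    by (simp add: S_def sum.distrib sum_distrib_left sum_distrib_right mult_ac)
  also have "int p dvd t * S"
  proof (cases "p = 2")
    case True
    with D4 t have "4 dvd 2 * t" by (auto simp: cong_iff_dvd_diff)
    then have "2 dvd t" by presburger
    with True show ?thesis by simp
  next
    case False
    have "2 * S = int p * (int p - 1)"
      unfolding S_def by (induction p) (auto simp: algebra_simps)
    then have "int p dvd 2 * S" by simp
    moreover have "\<not> int p dvd 2"
      using False p prime_ge_2_nat[OF p] by (auto dest: zdvd_imp_le)
    ultimately show ?thesis
      using p by (simp add: prime_dvd_mult_iff)
  qed
  then have "[int p + int p * (t * S) = int p] (mod int p ^ 2)"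
    by (auto simp: cong_iff_dvd_diff power2_eq_square)
  finally have *: "[(\<Sum>i<p. D ^ i) = int p] (mod int p ^ 2)" .
  have "\<not> int p ^ 2 dvd int p"
    using prime_ge_2_nat[OF p] by (auto simp: power2_eq_square)
  with * have nd: "\<not> int p ^ Suc 1 dvd (\<Sum>i<p. D ^ i)"
    by (simp add: cong_dvd_iff cong_sym_eq numeral_2_eq_2 del: power_Suc)
  then have "(\<Sum>i<p. D ^ i) \<noteq> 0" by (metis dvd_0_right)
  moreover have "\<not> is_unit (int p)" using p by auto
  ultimately have "multiplicity (int p) (\<Sum>i<p. D ^ i) < Suc 1"
    using nd by (intro multiplicity_lessI) auto
  then show ?thesis by simp
qed

text \<open>Factor \<open>D ^ k - 1\<close> as \<open>D - 1\<close> times a geometric sum. If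
  \<open>p\<close> does not divide \<open>k\<close>, that sum is \<open>k\<close> modulo
  \<open>p\<close> and contributes nothing. If \<open>k = p * j\<close>, replacing \<open>D\<close>
  by \<open>D ^ p\<close> costs at most 1 and leaves the exponent \<open>j\<close>; hence the
  induction over \<open>k\<close> with \<open>D\<close> arbitrary.\<close>

lemma multiplicity_power_minus_one_le:
  fixes D :: int
  assumes p: "prime p" and "D > 1" and "[D = 1] (mod int p)" and "p = 2 \<Longrightarrow> [D = 1] (mod 4)"
    and "k > 0"
  shows "multiplicity (int p) (D ^ k - 1) \<le> multiplicity (int p) (D - 1) + multiplicity p k"
  using assms(2-)
proof (induction k arbitrary: D rule: less_induct)
  case (less k D)
  have pe: "prime_elem (int p)" using p by simp
  have dist: "multiplicity (int p) (D ^ n - 1) =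
      multiplicity (int p) (D - 1) + multiplicity (int p) (\<Sum>i<n. D ^ i)" if "n > 0" for n
  proof -
    have "D ^ n - 1 = (D - 1) * (\<Sum>i<n. D ^ i)" by (rule power_diff_1_eq)
    moreover have "(\<Sum>i<n. D ^ i) > 0" using that less.prems by (intro sum_pos) auto
    ultimately show ?thesis
      using less.prems by (simp add: prime_elem_multiplicity_mult_distrib[OF pe])
  qed
  show ?case
  proof (cases "p dvd k")
    case False
    have "[(\<Sum>i<k. D ^ i) = (\<Sum>i<k. 1 ^ i)] (mod int p)"
      using less.prems by (intro cong_sum cong_pow)
    then have "[(\<Sum>i<k. D ^ i) = int k] (mod int p)" by simp
    with False have "\<not> int p dvd (\<Sum>i<k. D ^ i)"
      by (metis cong_dvd_iff int_dvd_int_iff)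
    then show ?thesis using dist[OF less.prems(4)] by (simp add: not_dvd_imp_multiplicity_0)
  next
    case True
    then obtain j where j: "k = p * j" by blast
    with less.prems have "j > 0" by (cases j) auto
    moreover have "p > 1" using p by (rule prime_gt_1_nat)
    ultimately have "j < k" using j by simp
    have "multiplicity (int p) ((D ^ p) ^ j - 1) \<le>
        multiplicity (int p) (D ^ p - 1) + multiplicity p j"
    proof (rule less.IH[OF \<open>j < k\<close> _ _ _ \<open>j > 0\<close>])
      show "D ^ p > 1" using less.prems \<open>p > 1\<close> by (intro one_less_power) auto
      show "[D ^ p = 1] (mod int p)"
        using cong_pow[OF less.prems(2), of p] by simp
      show "[D ^ p = 1] (mod 4)" if "p = 2"
        using cong_pow[OF less.prems(3)[OF that], of p] by simp
    qed
    moreover have "multiplicity (int p) (D ^ p - 1) \<le> multiplicity (int p) (D - 1) + 1"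
      using dist[of p] multiplicity_geometric_sum_le[OF p less.prems(2,3)] \<open>p > 1\<close> by simp
    moreover have "multiplicity p k = 1 + multiplicity p j"
      using j \<open>j > 0\<close> p by (simp add: prime_elem_multiplicity_mult_distrib)
    ultimately show ?thesis using j by (simp add: power_mult)
  qed
qed


section \<open>The cost of a single prime, measured as valuation times \<open>ln p\<close>\<close>

lemma multiplicity_mult_ln_le:
  fixes x :: int and p :: nat
  assumes "prime p" and "x \<noteq> 0"
  shows "real (multiplicity (int p) x) * ln (real p) \<le> ln \<bar>real_of_int x\<bar>"
proof -
  have p: "p > 0" using assms(1) by (rule prime_gt_0_nat)
  have "int p ^ multiplicity (int p) x \<le> \<bar>x\<bar>"
    using assms(2) by (intro zdvd_imp_le) (auto simp: multiplicity_dvd)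
  then have "real_of_int (int p ^ multiplicity (int p) x) \<le> real_of_int \<bar>x\<bar>"
    by (rule of_int_le_iff[THEN iffD2])
  then have "real p ^ multiplicity (int p) x \<le> \<bar>real_of_int x\<bar>" by simp
  then have "ln (real p ^ multiplicity (int p) x) \<le> ln \<bar>real_of_int x\<bar>"
    using p by (intro ln_mono) auto
  then show ?thesis using p by (simp add: ln_realpow)
qed

text \<open>Only the \<open>M div r\<close> multiples of the order \<open>r\<close> of
  \<open>a\<^sup>2\<close> contribute. The valuation \<open>v\<close> they share can be large, but
  \<open>v * ln p\<close> is at most \<open>2 * r * ln \<bar>a\<bar>\<close>, so the two occurrences
  of \<open>r\<close> cancel and the bound is uniform in \<open>p\<close>.\<close>

lemma sum_multiplicity_power_minus_one_le:
  fixes a :: int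
  assumes p: "prime p" and "\<not> int p dvd a" and a: "\<bar>a\<bar> > 1"
  shows "real (\<Sum>m=1..M. multiplicity (int p) (a ^ m - 1)) * ln (real p) \<le> 4 * real M * ln \<bar>real_of_int a\<bar>"
proof -
  \<comment> \<open>Passing to \<open>a\<^sup>2\<close> makes \<open>D\<close> below congruent to 1 modulo 4 when \<open>p = 2\<close>, so that \<open>p = 2\<close> needs no separate estimate.\<close>
  define d where "d = (nat \<bar>a\<bar>)\<^sup>2"
  have d: "int d = a\<^sup>2" by (simp add: d_def)
  have d1: "int d > 1" using one_less_power[OF a, of 2] by (simp add: d)
  have npd: "\<not> int p dvd int d"
    using assms(1,2) by (auto simp: d prime_dvd_power_iff)
  then have cop: "coprime p d"
    using p by (simp add: prime_imp_coprime)
  define r where "r = ord p d"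
  have r: "r > 0" using cop by (simp add: r_def)
  define D where "D = int d ^ r"
  have D1: "D > 1" using d1 r by (auto simp: D_def intro: one_less_power)
  have Dp: "[D = 1] (mod int p)"
    using ord[of d p] cong_int_iff[of "d ^ r" 1 p] by (simp add: D_def r_def)
  have D4: "[D = 1] (mod 4)" if "p = 2"
  proof -
    have "odd a" using assms(2) that by simp
    then obtain k where "a = 2 * k + 1" by (elim oddE)
    then have "a\<^sup>2 - 1 = 4 * (k\<^sup>2 + k)" by (simp add: power2_eq_square algebra_simps)
    then have "[int d = 1] (mod 4)" by (simp add: cong_iff_dvd_diff d)
    from cong_pow[OF this, of r] show ?thesis by (simp add: D_def)
  qed
  define v where "v = multiplicity (int p) (D - 1)"
  define K where "K = M div r"
  define L where "L = ln \<bar>real_of_int a\<bar>"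
  have L: "L \<ge> 0" using a by (auto simp: L_def)
  have "(\<Sum>m=1..M. multiplicity (int p) (a ^ m - 1)) \<le> (\<Sum>m=1..M. multiplicity (int p) (int d ^ m - 1))"
  proof (intro sum_mono dvd_imp_multiplicity_le)
    fix m assume "m \<in> {1..M}"
    then have "int d ^ m > 1" using d1 by (intro one_less_power) auto
    then show "int d ^ m - 1 \<noteq> 0" by simp
    have "int d ^ m - 1 = (a ^ m - 1) * (a ^ m + 1)"
      by (simp add: d power2_eq_square algebra_simps)
    then show "a ^ m - 1 dvd int d ^ m - 1" by simp
  qed
  also have "\<dots> = (\<Sum>k=1..K. multiplicity (int p) (int d ^ (r * k) - 1))"
    unfolding K_def
  proof (rule sum_multiples[OF r])
    fix m assume "\<not> r dvd m"
    then have "\<not> [d ^ m = 1] (mod p)" by (simp only: ord_divides r_def not_False_eq_True)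
    then have "\<not> [int d ^ m = 1] (mod int p)" using cong_int_iff[of "d ^ m" 1 p] by simp
    then show "multiplicity (int p) (int d ^ m - 1) = 0"
      by (intro not_dvd_imp_multiplicity_0) (simp add: cong_iff_dvd_diff)
  qed
  also have "\<dots> \<le> (\<Sum>k=1..K. v + multiplicity p k)"
    unfolding power_mult D_def[symmetric] v_def
    by (intro sum_mono multiplicity_power_minus_one_le p D1 Dp D4) auto
  also have "\<dots> = K * v + (\<Sum>k=1..K. multiplicity p k)"
    by (simp only: sum.distrib) simp
  also have "\<dots> \<le> K * (v + 1)"
    using sum_multiplicity_le[OF p, of K] by simp
  \<comment> \<open>Since \<open>p\<close> divides \<open>D - 1\<close>, \<open>v\<close> is
    positive and absorbs the 1 coming from the valuations of \<open>k\<close>. No separate bound on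
    \<open>ln p\<close> is then required, only one on \<open>v * ln p\<close>.\<close>
  also have "v + 1 \<le> 2 * v"
  proof -
    have "int p dvd D - 1" using Dp by (simp add: cong_iff_dvd_diff)
    moreover have "D - 1 \<noteq> 0" using D1 by simp
    ultimately have "v > 0" using p by (simp add: v_def prime_multiplicity_gt_zero_iff)
    then show ?thesis by simp
  qed
  finally have le: "(\<Sum>m=1..M. multiplicity (int p) (a ^ m - 1)) \<le> K * (2 * v)"
    by (simp del: One_nat_def)
  have lnp: "ln (real p) \<ge> 0" using prime_ge_1_nat[OF p] by simp
  have "real (\<Sum>m=1..M. multiplicity (int p) (a ^ m - 1)) * ln (real p) \<le> real (K * (2 * v)) * ln (real p)"
    using le lnp by (intro mult_right_mono of_nat_mono)
  also have "\<dots> = 2 * real K * (real v * ln (real p))" by simp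
  also have "\<dots> \<le> 2 * real K * (2 * real r * L)"
  proof (intro mult_left_mono)
    have "real v * ln (real p) \<le> ln \<bar>real_of_int (D - 1)\<bar>"
      unfolding v_def using D1 by (intro multiplicity_mult_ln_le p) auto
    also have "\<dots> \<le> ln (real_of_int D)" using D1 by (intro ln_mono) auto
    also have "real_of_int D = \<bar>real_of_int a\<bar> ^ (2 * r)"
      by (simp add: D_def d power_mult del: of_int_of_nat_eq)
    also have "ln \<dots> = 2 * real r * L"
      using a by (simp add: ln_realpow L_def)
    finally show "real v * ln (real p) \<le> 2 * real r * L" .
  qed simp
  also have "\<dots> = 4 * real (r * K) * L" by simp
  also have "\<dots> \<le> 4 * real M * L"
    using L by (intro mult_right_mono mult_left_mono of_nat_mono) (simp_all add: K_def)
  finally show ?thesis by (simp add: L_def)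
qed

lemma sum_comp_inj_le:
  fixes g :: "'b \<Rightarrow> nat"
  assumes "inj_on h A" "h ` A \<subseteq> B" "finite B"
  shows "(\<Sum>x\<in>A. g (h x)) \<le> sum g B"
proof -
  have "(\<Sum>x\<in>A. g (h x)) = sum g (h ` A)" using assms(1) by (simp add: sum.reindex)
  also have "\<dots> \<le> sum g B" using assms by (intro sum_mono2) auto
  finally show ?thesis .
qed

text \<open>Subtracting the two terms eliminates \<open>b\<close> and leaves
  \<open>a ^ m * (a ^ (n - m) - 1)\<close>, whose first factor is prime to \<open>p\<close>.\<close>

lemma multiplicity_power_minus_le:
  fixes a b :: int
  assumes p: "prime p" and nd: "\<not> int p dvd a" and a: "\<bar>a\<bar> > 1" and "m < n"
    and "int p ^ k dvd a ^ m - b" "int p ^ k dvd a ^ n - b"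
  shows "k \<le> multiplicity (int p) (a ^ (n - m) - 1)"
proof -
  have "int p ^ k dvd (a ^ n - b) - (a ^ m - b)" using assms(6,5) by (rule dvd_diff)
  also have "(a ^ n - b) - (a ^ m - b) = a ^ m * (a ^ (n - m) - 1)"
    using \<open>m < n\<close> by (simp add: algebra_simps flip: power_add)
  finally have "int p ^ k dvd a ^ m * (a ^ (n - m) - 1)" .
  moreover have "coprime (int p ^ k) (a ^ m)"
    using p nd by (simp add: prime_imp_coprime)
  ultimately have "int p ^ k dvd a ^ (n - m) - 1"
    by (simp add: coprime_dvd_mult_right_iff)
  moreover have "\<bar>a ^ (n - m)\<bar> > 1"
    unfolding power_abs using a \<open>m < n\<close> by (intro one_less_power) auto
  then have "a ^ (n - m) - 1 \<noteq> 0" by auto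
  moreover have "\<not> is_unit (int p)" using p by auto
  ultimately show ?thesis by (intro multiplicity_geI) auto
qed

lemma sum_multiplicity_power_minus_le:
  fixes a b :: int
  assumes p: "prime p" and nd: "\<not> int p dvd a" and a: "\<bar>a\<bar> > 1"
    and X: "\<And>n. n \<in> {M<..2 * M} \<Longrightarrow> a ^ n \<noteq> b \<and> ln \<bar>real_of_int (a ^ n - b)\<bar> \<le> X"
    and "X \<ge> 0"
  shows "real (\<Sum>n\<in>{M<..2 * M}. multiplicity (int p) (a ^ n - b)) * ln (real p)
           \<le> X + 8 * real M * ln \<bar>real_of_int a\<bar>"
proof (cases "M = 0")
  case True
  then show ?thesis using assms(5) by simp
next
  case False
  define f where "f n = multiplicity (int p) (a ^ n - b)" for n
  define g where "g m = multiplicity (int p) (a ^ m - 1)" for m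
  define W where "W = {M<..2 * M}"
  have W: "finite W" "W \<noteq> {}" using False by (auto simp: W_def)
  \<comment> \<open>As \<open>N\<close> maximises the valuation, \<open>p ^ f n\<close> divides both
    \<open>a ^ n - b\<close> and \<open>a ^ N - b\<close> for every \<open>n\<close> in
    \<open>W\<close>, so each \<open>n\<close> is compared with \<open>N\<close> alone.\<close>
  have "Max (f ` W) \<in> f ` W" using W by (intro Max_in) auto
  then obtain N where N: "N \<in> W" "Max (f ` W) = f N" by auto
  have fN: "f n \<le> f N" if "n \<in> W" for n
    using that W N by (metis Max_ge finite_imageI imageI)
  have dvd: "int p ^ f n dvd a ^ n - b" "int p ^ f n dvd a ^ N - b" if "n \<in> W" for n
    using fN[OF that] by (auto simp: f_def intro: multiplicity_dvd multiplicity_dvd')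
  have lt: "f n \<le> g (N - n)" if "n \<in> {M<..<N}" for n
    unfolding g_def using that N(1) dvd[of n]
    by (intro multiplicity_power_minus_le[OF p nd a, of _ _ _ b]) (auto simp: W_def)
  have gt: "f n \<le> g (n - N)" if "n \<in> {N<..2 * M}" for n
    unfolding g_def using that N(1) dvd[of n]
    by (intro multiplicity_power_minus_le[OF p nd a, of _ _ _ b]) (auto simp: W_def)
  have "W = insert N ({M<..<N} \<union> {N<..2 * M})" using N(1) by (auto simp: W_def)
  then have "sum f W = f N + (sum f {M<..<N} + sum f {N<..2 * M})"
    using N(1) sum.union_disjoint[of "{M<..<N}" "{N<..2 * M}" f] by (auto simp: Int_def)
  also have "sum f {M<..<N} \<le> (\<Sum>n\<in>{M<..<N}. g (N - n))" by (intro sum_mono lt)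
  also have "\<dots> \<le> sum g {1..M}"
    using N(1) by (intro sum_comp_inj_le) (auto simp: W_def inj_on_def)
  also have "sum f {N<..2 * M} \<le> (\<Sum>n\<in>{N<..2 * M}. g (n - N))" by (intro sum_mono gt)
  also have "\<dots> \<le> sum g {1..M}"
    using N(1) by (intro sum_comp_inj_le) (auto simp: W_def inj_on_def)
  \<comment> \<open>On either side of \<open>N\<close> the distances to \<open>N\<close> are
    distinct and lie in \<open>{1..M}\<close>, so each side costs one copy of
    \<open>sum g {1..M}\<close>. Two copies at \<open>4 * M * ln \<bar>a\<bar>\<close> give the 8 in
    the claim.\<close>
  finally have le: "sum f W \<le> f N + 2 * sum g {1..M}" by (simp del: One_nat_def)
  have lnp: "ln (real p) \<ge> 0" using prime_ge_1_nat[OF p] by simp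
  have "real (sum f W) * ln (real p) \<le> real (f N + 2 * sum g {1..M}) * ln (real p)"
    using le lnp by (intro mult_right_mono of_nat_mono)
  also have "\<dots> = real (f N) * ln (real p) + 2 * (real (sum g {1..M}) * ln (real p))"
    by (simp add: algebra_simps)
  also have "real (f N) * ln (real p) \<le> ln \<bar>real_of_int (a ^ N - b)\<bar>"
    unfolding f_def using N(1) X by (intro multiplicity_mult_ln_le p) (auto simp: W_def)
  also have "\<dots> \<le> X" using N(1) X by (auto simp: W_def)
  also have "real (sum g {1..M}) * ln (real p) \<le> 4 * real M * ln \<bar>real_of_int a\<bar>"
    unfolding g_def by (rule sum_multiplicity_power_minus_one_le[OF p nd a])
  finally show ?thesis by (simp add: f_def W_def)
qed

text \<open>If \<open>p\<close> divides \<open>b\<close> but not \<open>a\<close>, the valuation is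
  0. If \<open>p\<close> divides \<open>a\<close>, then \<open>\<bar>b\<bar> < 2 ^ n\<close> keeps
  the valuation below \<open>n\<close>, so that power of \<open>p\<close> divides
  \<open>a ^ n\<close> and therefore \<open>b\<close>. The bound does not depend on
  \<open>n\<close>.\<close>

lemma multiplicity_power_minus_common_prime_le:
  fixes a b :: int
  assumes p: "prime p" and dvd: "int p dvd a * b" and b: "b \<noteq> 0" "\<bar>b\<bar> < 2 ^ n" and "n > 0"
  shows "real (multiplicity (int p) (a ^ n - b)) * ln (real p) \<le> ln \<bar>real_of_int b\<bar>"
proof (cases "int p dvd a")
  case False
  with dvd p have b_dvd: "int p dvd b" by (simp add: prime_dvd_mult_iff)
  have "\<not> int p dvd a ^ n - b"
  proof
    assume "int p dvd a ^ n - b"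
    from dvd_add[OF this b_dvd] have "int p dvd a ^ n" by simp
    with False p show False using prime_dvd_power[of "int p" a n] by simp
  qed
  then show ?thesis using b(1) by (simp add: not_dvd_imp_multiplicity_0)
next
  case True
  define v where "v = multiplicity (int p) (a ^ n - b)"
  have pn: "int p ^ n dvd a ^ n" using True by (rule dvd_power_same)
  have "v < n"
  proof (rule ccontr)
    assume "\<not> v < n"
    then have "int p ^ n dvd a ^ n - b" by (auto simp: v_def intro: multiplicity_dvd')
    from dvd_diff[OF pn this] have "int p ^ n dvd b" by simp
    then have "int p ^ n \<le> \<bar>b\<bar>" using b(1) by (intro zdvd_imp_le) auto
    moreover have "2 ^ n \<le> int p ^ n"
      using prime_ge_2_nat[OF p] by (intro power_mono) auto
    ultimately show False using b(2) by simp
  qed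
  then have "int p ^ v dvd a ^ n" using pn by (meson dvd_trans le_imp_power_dvd less_imp_le)
  moreover have "int p ^ v dvd a ^ n - b" by (simp add: v_def multiplicity_dvd)
  ultimately have "int p ^ v dvd a ^ n - (a ^ n - b)" by (rule dvd_diff)
  then have "int p ^ v dvd b" by simp
  moreover have "\<not> is_unit (int p)" using p by auto
  ultimately have "v \<le> multiplicity (int p) b" using b(1) by (intro multiplicity_geI) auto
  then have "real v * ln (real p) \<le> real (multiplicity (int p) b) * ln (real p)"
    using prime_ge_1_nat[OF p] by (intro mult_right_mono) auto
  also have "\<dots> \<le> ln \<bar>real_of_int b\<bar>" using b(1) by (intro multiplicity_mult_ln_le p)
  finally show ?thesis by (simp add: v_def)
qed

section \<open>From single primes to the count\<close>

text \<open>Logarithm of the prime factorisation. \<open>P\<close> may exceed the set of prime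
  factors, so one \<open>P\<close> can serve all terms \<open>a ^ n - b\<close> and the sums over
  \<open>n\<close> and \<open>p\<close> can be interchanged.\<close>

lemma ln_le_sum_multiplicity:
  fixes x :: int
  assumes "x \<noteq> 0" and "finite P" and P: "\<And>p. p \<in> P \<Longrightarrow> prime p"
    and "\<And>p. prime p \<Longrightarrow> int p dvd x \<Longrightarrow> p \<in> P"
  shows "ln \<bar>real_of_int x\<bar> \<le> (\<Sum>p\<in>P. real (multiplicity (int p) x) * ln (real p))"
proof -
  have pos: "q > 0" if "q \<in> prime_factors x" for q
    using that by (auto simp: in_prime_factors_iff prime_gt_0_int)
  have sub: "prime_factors x \<subseteq> int ` P"
  proof
    fix q assume q: "q \<in> prime_factors x"
    then have "prime (nat q)" "int (nat q) dvd x"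
      using pos[OF q] by (auto simp: in_prime_factors_iff)
    then have "nat q \<in> P" by (rule assms(4))
    then show "q \<in> int ` P" using pos[OF q] by force
  qed
  have "\<bar>real_of_int x\<bar> = real_of_int (\<Prod>q\<in>prime_factors x. q ^ multiplicity q x)"
    using prod_prime_factors[OF assms(1)] by simp
  also have "ln \<dots> = (\<Sum>q\<in>prime_factors x. real (multiplicity q x) * ln (real_of_int q))"
    using pos by (simp add: ln_prod ln_realpow)
  also have "\<dots> \<le> (\<Sum>q\<in>int ` P. real (multiplicity q x) * ln (real_of_int q))"
    using assms(2) sub prime_ge_1_nat[OF P] by (intro sum_mono2) auto
  also have "\<dots> = (\<Sum>p\<in>P. real (multiplicity (int p) x) * ln (real p))"
    by (simp add: sum.reindex)
  finally show ?thesis .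
qed

text \<open>Because \<open>2 * \<bar>b\<bar> \<le> \<bar>a\<bar> ^ M\<close> and
  \<open>2 * \<bar>a\<bar> ^ M \<le> \<bar>a ^ n\<bar>\<close>, subtracting \<open>b\<close> changes
  the size of \<open>a ^ n\<close> by less than a factor 2, and a factor 2 is at most one more power
  of \<open>\<bar>a\<bar>\<close>.\<close>

lemma power_minus_bounds:
  fixes a b :: int
  assumes a: "\<bar>a\<bar> > 1" and b: "2 * \<bar>b\<bar> \<le> 2 ^ M" and n: "M < n" "n \<le> 2 * M"
  shows "\<bar>a\<bar> ^ M \<le> \<bar>a ^ n - b\<bar>" and "\<bar>a ^ n - b\<bar> \<le> \<bar>a\<bar> ^ (3 * M)"
proof -
  have "2 ^ M \<le> \<bar>a\<bar> ^ M" using a by (intro power_mono) auto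
  with b have b': "2 * \<bar>b\<bar> \<le> \<bar>a\<bar> ^ M" by simp
  have "2 * \<bar>a\<bar> ^ M \<le> \<bar>a\<bar> * \<bar>a\<bar> ^ M" using a by (intro mult_right_mono) auto
  also have "\<dots> \<le> \<bar>a\<bar> ^ n" using a n power_increasing[of "Suc M" n "\<bar>a\<bar>"] by simp
  finally have an: "2 * \<bar>a\<bar> ^ M \<le> \<bar>a ^ n\<bar>" by (simp add: power_abs)
  have pos: "0 \<le> \<bar>a\<bar> ^ M" by simp
  show "\<bar>a\<bar> ^ M \<le> \<bar>a ^ n - b\<bar>" using an b' pos abs_triangle_ineq2[of "a ^ n" b] by linarith
  have "\<bar>a ^ n - b\<bar> \<le> 2 * \<bar>a ^ n\<bar>" using an b' pos abs_triangle_ineq4[of "a ^ n" b] by linarith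
  also have "\<dots> \<le> \<bar>a\<bar> * \<bar>a\<bar> ^ n" unfolding power_abs using a by (intro mult_right_mono) auto
  \<comment> \<open>\<open>M < n \<le> 2 * M\<close> forces \<open>M \<ge> 1\<close>, hence
    \<open>n + 1 \<le> 3 * M\<close>.\<close>
  also have "\<dots> \<le> \<bar>a\<bar> ^ (3 * M)" using a n power_increasing[of "Suc n" "3 * M" "\<bar>a\<bar>"] by simp
  finally show "\<bar>a ^ n - b\<bar> \<le> \<bar>a\<bar> ^ (3 * M)" .
qed

text \<open>Double counting of the sum of \<open>ln \<bar>a ^ n - b\<bar>\<close> over the
  \<open>M\<close> exponents in \<open>W\<close>. Each term is at least \<open>M * L\<close>, while
  each prime in \<open>S\<close> accounts for at most \<open>11 * M * L\<close> and each prime in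
  \<open>T\<close> for at most \<open>M * B\<close>. Dividing by \<open>M\<close> gives the claim.
  The 11 is 3 from the size of the largest term plus 8 from the remaining ones.\<close>

lemma card_primes_with_power_residue_ge:
  fixes a b :: int
  assumes a: "\<bar>a\<bar> > 1" and b0: "b \<noteq> 0" and M: "M > 0" and b: "2 * \<bar>b\<bar> \<le> 2 ^ M"
    and x: "\<bar>real_of_int a\<bar> ^ (3 * M) \<le> x"
  shows "real M * ln \<bar>real_of_int a\<bar> \<le>
    11 * ln \<bar>real_of_int a\<bar> * real (card (primes_with_power_residue a b x))
    + ln \<bar>real_of_int b\<bar> * real (card {p::nat. prime p \<and> int p dvd a * b})"
proof -
  define L where "L = ln \<bar>real_of_int a\<bar>"
  define B where "B = ln \<bar>real_of_int b\<bar>"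
  define S where "S = primes_with_power_residue a b x"
  define T where "T = {p::nat. prime p \<and> int p dvd a * b}"
  define W where "W = {M<..2 * M}"
  have L: "L > 0" using a by (simp add: L_def)
  have finS: "finite S" by (simp add: S_def finite_primes_with_power_residue)
  have "T \<subseteq> {..nat \<bar>a * b\<bar>}"
  proof
    fix p assume "p \<in> T"
    then have "int p \<le> \<bar>a * b\<bar>" using a b0 by (intro zdvd_imp_le) (auto simp: T_def)
    then show "p \<in> {..nat \<bar>a * b\<bar>}" by simp
  qed
  then have finT: "finite T" by (rule finite_subset) simp
  have bounds: "\<bar>a\<bar> ^ M \<le> \<bar>a ^ n - b\<bar>" "\<bar>a ^ n - b\<bar> \<le> \<bar>a\<bar> ^ (3 * M)" if "n \<in> W" for n
    using power_minus_bounds[OF a b, of n] that by (auto simp: W_def)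
  have nz: "a ^ n - b \<noteq> 0" if "n \<in> W" for n
  proof -
    have "0 < \<bar>a\<bar> ^ M" using a by simp
    then have "\<bar>a ^ n - b\<bar> > 0" using bounds(1)[OF that] by linarith
    then show ?thesis by simp
  qed
  have lower: "real M * L \<le> ln \<bar>real_of_int (a ^ n - b)\<bar>" if "n \<in> W" for n
  proof -
    have "real_of_int (\<bar>a\<bar> ^ M) \<le> real_of_int \<bar>a ^ n - b\<bar>"
      using bounds(1)[OF that] by (rule of_int_le_iff[THEN iffD2])
    then have "ln (\<bar>real_of_int a\<bar> ^ M) \<le> ln \<bar>real_of_int (a ^ n - b)\<bar>"
      using a by (intro ln_mono) auto
    then show ?thesis using a by (simp add: ln_realpow L_def)
  qed
  have upper: "ln \<bar>real_of_int (a ^ n - b)\<bar> \<le> 3 * real M * L" if "n \<in> W" for n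
  proof -
    have "real_of_int \<bar>a ^ n - b\<bar> \<le> real_of_int (\<bar>a\<bar> ^ (3 * M))"
      using bounds(2)[OF that] by (rule of_int_le_iff[THEN iffD2])
    then have "ln \<bar>real_of_int (a ^ n - b)\<bar> \<le> ln (\<bar>real_of_int a\<bar> ^ (3 * M))"
      using nz[OF that] by (intro ln_mono) auto
    then show ?thesis using a by (simp add: ln_realpow L_def)
  qed
  \<comment> \<open>The hypothesis on \<open>x\<close> enters here: every prime factor of a term is
    at most \<open>\<bar>a\<bar> ^ (3 * M)\<close>, hence at most \<open>x\<close>.\<close>
  have inST: "p \<in> S \<union> T" if p: "prime p" and dvd: "int p dvd a ^ n - b" and n: "n \<in> W" for p n
  proof (cases "int p dvd a * b")
    case False
    then have "\<not> int p dvd a" by auto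
    moreover have "[b = a ^ n] (mod int p)"
      using dvd by (simp add: cong_iff_dvd_diff dvd_diff_commute)
    ultimately have "b mod int p \<in> cyclic_subgroup_mod a p"
      using mod_in_cyclic_subgroup_mod_iff[OF p] by blast
    moreover have "int p \<le> \<bar>a ^ n - b\<bar>" using dvd nz[OF n] by (intro zdvd_imp_le) auto
    then have "int p \<le> \<bar>a\<bar> ^ (3 * M)" using bounds(2)[OF n] by simp
    then have "real_of_int (int p) \<le> real_of_int (\<bar>a\<bar> ^ (3 * M))"
      by (rule of_int_le_iff[THEN iffD2])
    then have "real p \<le> x" using x by simp
    ultimately show ?thesis
      using False p by (simp add: S_def primes_with_power_residue_def)
  qed (use p in \<open>simp add: T_def\<close>)
  have disj: "S \<inter> T = {}" by (auto simp: S_def T_def primes_with_power_residue_def)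
  have prime: "prime p" if "p \<in> S \<union> T" for p
    using that by (auto simp: S_def T_def primes_with_power_residue_def)
  define F where "F p = real (\<Sum>n\<in>W. multiplicity (int p) (a ^ n - b)) * ln (real p)" for p
  have FS: "F p \<le> 11 * real M * L" if "p \<in> S" for p
  proof -
    have nd: "\<not> int p dvd a" using that by (auto simp: S_def primes_with_power_residue_def)
    have "F p \<le> 3 * real M * L + 8 * real M * ln \<bar>real_of_int a\<bar>"
      unfolding F_def W_def using that prime nd a upper nz L
      by (intro sum_multiplicity_power_minus_le) (auto simp: W_def)
    then show ?thesis by (simp add: L_def)
  qed
  have FT: "F p \<le> real M * B" if "p \<in> T" for p
  proof -
    have "F p = (\<Sum>n\<in>W. real (multiplicity (int p) (a ^ n - b)) * ln (real p))"
      by (simp add: F_def sum_distrib_right)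
    also have "\<dots> \<le> (\<Sum>n\<in>W. B)"
    proof (rule sum_mono)
      fix n assume n: "n \<in> W"
      have "(2::int) ^ M < 2 ^ n" using n by (intro power_strict_increasing) (auto simp: W_def)
      then have "\<bar>b\<bar> < 2 ^ n" using b by linarith
      then show "real (multiplicity (int p) (a ^ n - b)) * ln (real p) \<le> B"
        unfolding B_def using that b0 n
        by (intro multiplicity_power_minus_common_prime_le) (auto simp: T_def W_def)
    qed
    finally show ?thesis by (simp add: W_def)
  qed
  have "real M * (real M * L) = (\<Sum>n\<in>W. real M * L)" by (simp add: W_def)
  also have "\<dots> \<le> (\<Sum>n\<in>W. ln \<bar>real_of_int (a ^ n - b)\<bar>)" by (intro sum_mono lower)
  also have "\<dots> \<le> (\<Sum>n\<in>W. \<Sum>p\<in>S \<union> T. real (multiplicity (int p) (a ^ n - b)) * ln (real p))"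
    using finS finT prime inST nz by (intro sum_mono ln_le_sum_multiplicity) auto
  also have "\<dots> = (\<Sum>p\<in>S \<union> T. F p)"
    by (subst sum.swap) (simp add: F_def sum_distrib_right)
  also have "\<dots> = sum F S + sum F T" using finS finT disj by (rule sum.union_disjoint)
  also have "\<dots> \<le> (\<Sum>p\<in>S. 11 * real M * L) + (\<Sum>p\<in>T. real M * B)"
    by (intro add_mono sum_mono FS FT)
  also have "\<dots> = real M * (11 * L * real (card S) + B * real (card T))"
    by (simp add: algebra_simps)
  finally show ?thesis using M by (simp add: L_def B_def S_def T_def)
qed

theorem theorem1p1:
  fixes a b :: int
  assumes "a \<noteq> 0" and "b \<noteq> 0" and "\<bar>a\<bar> \<noteq> 1"
  shows "\<exists>c x0 :: real. c > 0 \<and>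
    (\<forall>x::real. x \<ge> x0 \<longrightarrow> real (card (primes_with_power_residue a b x)) \<ge> c * ln x)"
proof -
  have a: "\<bar>a\<bar> > 1" using assms(1,3) by simp
  define L where "L = ln \<bar>real_of_int a\<bar>"
  define B where "B = ln \<bar>real_of_int b\<bar>"
  define t where "t = real (card {p::nat. prime p \<and> int p dvd a * b})"
  define m where "m = nat (2 * \<bar>b\<bar>)"
  have L: "L > 0" using a by (simp add: L_def)
  have B: "B \<ge> 0" using assms(2) by (simp add: B_def)
  have t: "t \<ge> 0" by (simp add: t_def)
  have Bt_Lm: "B * t \<ge> 0" "L * real m \<ge> 0" using B t L by simp_all
  \<comment> \<open>For \<open>ln x \<ge> X\<close>, the rounding loss \<open>L\<close> and the
    contribution \<open>B * t\<close> of the primes dividing \<open>a * b\<close> together take at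
    most \<open>ln x / 6\<close>. The summand \<open>L * m\<close> ensures
    \<open>M \<ge> m\<close>.\<close>
  define X where "X = 6 * (L + B * t + L * real m)"
  \<comment> \<open>66 is 6 times 11: of the main term \<open>ln x / 3\<close> at least
    \<open>ln x / 6\<close> survives, and it is bounded by \<open>11 * L\<close> times the
    count.\<close>
  have "1 / (66 * L) * ln x \<le> real (card (primes_with_power_residue a b x))" if "x \<ge> exp X" for x
  proof -
    have x: "x > 0" using that by (rule less_le_trans[OF exp_gt_zero])
    have X: "X \<le> ln x" using that x by (simp add: ln_ge_iff)
    \<comment> \<open>\<open>y\<close> solves \<open>\<bar>a\<bar> ^ (3 * y) = x\<close> over the
      reals, so its floor \<open>M\<close> is the largest exponent the counting bound
      admits.\<close>
    define y where "y = ln x / (3 * L)"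
    define M where "M = nat \<lfloor>y\<rfloor>"
    have "real m + 1 \<le> y"
    proof -
      have "(real m + 1) * (3 * L) = 3 * (L * real m) + 3 * L"
        by (simp add: algebra_simps)
      then have "(real m + 1) * (3 * L) \<le> ln x"
        using X L Bt_Lm unfolding X_def ring_distribs by linarith
      then show ?thesis using L by (simp add: y_def pos_le_divide_eq)
    qed
    then have M: "real M \<le> y" "y < real M + 1" unfolding M_def by linarith+
    have "m \<le> M" using M(2) \<open>real m + 1 \<le> y\<close> by linarith
    have "2 * \<bar>b\<bar> = int m" by (simp add: m_def)
    \<comment> \<open>Uses only \<open>m \<le> M < 2 ^ M\<close>.\<close>
    also have "\<dots> \<le> int (2 ^ M)"
      using \<open>m \<le> M\<close> less_exp[of M] by linarith
    finally have b: "2 * \<bar>b\<bar> \<le> 2 ^ M" by simp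
    have "m > 0" using assms(2) by (simp add: m_def)
    have "ln (\<bar>real_of_int a\<bar> ^ (3 * M)) = 3 * L * real M"
      using a by (simp add: ln_realpow L_def)
    also have "\<dots> \<le> ln x" using M(1) L by (simp add: y_def field_simps)
    finally have "\<bar>real_of_int a\<bar> ^ (3 * M) \<le> x"
      using x a by (subst (asm) ln_le_cancel_iff) auto
    from card_primes_with_power_residue_ge[OF a assms(2) _ b this] \<open>m \<le> M\<close> \<open>m > 0\<close>
    have "real M * L \<le> 11 * L * real (card (primes_with_power_residue a b x)) + B * t"
      by (simp add: L_def B_def t_def)
    moreover have "ln x / 3 = y * L" using L by (simp add: y_def)
    moreover have "y * L \<le> (real M + 1) * L" using M(2) L by (intro mult_right_mono) auto
    moreover have "L + B * t \<le> ln x / 6"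
      using X Bt_Lm unfolding X_def ring_distribs by linarith
    ultimately have "ln x / 6 \<le> 11 * L * real (card (primes_with_power_residue a b x))"
      by (simp add: algebra_simps)
    then show ?thesis using L by (simp add: field_simps)
  qed
  then show ?thesis using L by (intro exI[of _ "1 / (66 * L)"] exI[of _ "exp X"]) auto
qed

end
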